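(* Let $\{g_{S}: S\in\mathrm{Tab}_\tau\}$ be a basis for a space of polynomials of isotype $\tau$ for $\mathcal{S}_N$. Then the linear map $$\rho:\mathcal{P}_\tau\to\mathcal{P},\qquad \sum_{S\in\mathrm{Tab}_\tau} f_{S}(x)\otimes S\ \longmapsto\ \sum_{S\in\mathrm{Tab}_\tau} f_{S}(x)\,g_{S}(x)$$ intertwines $\mathbf{t}_\sigma$ with $\sigma$ for all $\sigma\in\mathcal{S}_N$; that is, $\mathbf{t}_\sigma\,\rho=\rho\,\sigma$ (operators act on the right, so $(p\,\mathbf t_\sigma)\rho=(p\rho)\sigma$ for all $p\in\mathcal P_\tau$).
   Context: Tableaux. Let $N\ge 2$ and let $\tau$ be a partition of $N$. Its Ferrers diagram is the set of boxes $(i,j)$ (row $i$, column $j$), $1\le i\le \ell(\tau)$, $1\le j\le\tau_i$. $\mathrm{Tab}_\tau$ is the set of reverse standard Young tableaux of shape $\tau$: fillings of the boxes by $1,\dots,N$, each used once, decreasing along each row (as $j$ increases) and along each column (as $i$ increases). For $S\in\mathrm{Tab}_\tau$ the entry $k$ is in box $(\mathrm{row}_S[k],\mathrm{col}_S[k])$ and its content is $c_S[k]=\mathrm{col}_S[k]-\mathrm{row}_S[k]$. $S^{(i)}$ is the tableau obtained from $S$ by exchanging $i$ and $i+1$. Let $\mathbb F$ be an extension field of $\mathbb C$ and $V_\tau$ the $\mathbb F$-vector space with basis $\mathrm{Tab}_\tau$. All operators act on the right. The representation $\tau$ of $\mathcal S_N$ on $V_\tau$ is given, for the simple transpositions $s_i=(i,i+1)$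 and $b=c_S[i]-c_S[i+1]$, by: (I) if $\mathrm{row}_S[i]=\mathrm{row}_S[i+1]$, $S\tau(s_i)=S$; (II) if $\mathrm{col}_S[i]=\mathrm{col}_S[i+1]$, $S\tau(s_i)=-S$; (III) if $\mathrm{row}_S[i]<\mathrm{row}_S[i+1]$ and $\mathrm{col}_S[i]>\mathrm{col}_S[i+1]$, $S\tau(s_i)=S^{(i)}+\frac1b S$; (IV) if $b\le -2$, $S\tau(s_i)=\left(1-\frac1{b^2}\right)S^{(i)}+\frac1b S$. $\mathcal P=\mathbb F[x_1,\dots,x_N]$ with the right action of $\mathcal S_N$ in which $s_i$ exchanges the variables $x_i$ and $x_{i+1}$. $\mathcal P_\tau=\mathcal P\otimes V_\tau$, and $\mathbf t_\sigma=\sigma\otimes\tau(\sigma)$. A basis $\{g_S:S\in\mathrm{Tab}_\tau\}$ of an $\mathcal S_N$-invariant space of polynomials is a basis for a space of polynomials of isotype $\tau$ for $\mathcal S_N$ if each $g_S s_i$ is given by the formulas (I)–(IV) with $S$, $S^{(i)}$ replaced by $g_S$, $g_{S^{(i)}}$. *)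

theory Defs
  imports "HOL-Library.Poly_Mapping" "HOL-Library.FuncSet" "HOL-Combinatorics.Permutations" Complex_Main
begin

definition field_extension_of_complex :: "(complex \<Rightarrow> 'a::field) \<Rightarrow> bool" where
  "field_extension_of_complex \<iota> \<longleftrightarrow>
     \<iota> 1 = 1 \<and> (\<forall>x y. \<iota> (x + y) = \<iota> x + \<iota> y) \<and> (\<forall>x y. \<iota> (x * y) = \<iota> x * \<iota> y)"


section \<open>Reverse standard Young tableaux\<close>

definition partition_of :: "nat \<Rightarrow> nat list \<Rightarrow> bool" where
  "partition_of N \<mu> \<longleftrightarrow> sorted_wrt (\<ge>) \<mu> \<and> (\<forall>p\<in>set \<mu>. 1 \<le> p) \<and> sum_list \<mu> = N"

definition boxes :: "nat list \<Rightarrow> (nat \<times> nat) set" where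
  "boxes \<mu> = {(i, j). 1 \<le> i \<and> i \<le> length \<mu> \<and> 1 \<le> j \<and> j \<le> \<mu> ! (i - 1)}"

text \<open>A filling is normalised to be \<open>undefined\<close> off the diagram, so that equality of
  tableaux is equality of their entries.\<close>

type_synonym tableau = "nat \<times> nat \<Rightarrow> nat"

definition Tab :: "nat list \<Rightarrow> tableau set" where
  "Tab \<mu> = {S \<in> extensional (boxes \<mu>).
     bij_betw S (boxes \<mu>) {1..sum_list \<mu>} \<and>
     (\<forall>i j j'. (i, j) \<in> boxes \<mu> \<and> (i, j') \<in> boxes \<mu> \<and> j < j' \<longrightarrow> S (i, j') < S (i, j)) \<and>
     (\<forall>i i' j. (i, j) \<in> boxes \<mu> \<and> (i', j) \<in> boxes \<mu> \<and> i < i' \<longrightarrow> S (i', j) < S (i, j))}"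

definition row :: "nat list \<Rightarrow> tableau \<Rightarrow> nat \<Rightarrow> nat" where
  "row \<mu> S k = fst (the_inv_into (boxes \<mu>) S k)"

definition col :: "nat list \<Rightarrow> tableau \<Rightarrow> nat \<Rightarrow> nat" where
  "col \<mu> S k = snd (the_inv_into (boxes \<mu>) S k)"

definition content :: "nat list \<Rightarrow> tableau \<Rightarrow> nat \<Rightarrow> int" where
  "content \<mu> S k = int (col \<mu> S k) - int (row \<mu> S k)"

abbreviation simple_transp :: "nat \<Rightarrow> nat \<Rightarrow> nat" where
  "simple_transp i \<equiv> transpose i (i + 1)"

definition swap_entries :: "nat list \<Rightarrow> nat \<Rightarrow> tableau \<Rightarrow> tableau" where
  "swap_entries \<mu> i S = restrict (simple_transp i \<circ> S) (boxes \<mu>)"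


section \<open>Finitely supported functions as vector spaces\<close>

definition smul :: "'a::field \<Rightarrow> ('k \<Rightarrow>\<^sub>0 'a) \<Rightarrow> ('k \<Rightarrow>\<^sub>0 'a)" where
  "smul c v = Poly_Mapping.map ((*) c) v"

lemma lookup_smul [simp]:
  "Poly_Mapping.lookup (smul c v) k = c * Poly_Mapping.lookup v k"
  by (simp add: smul_def Poly_Mapping.map.rep_eq when_def)

global_interpretation pm: vector_space "smul :: 'a::field \<Rightarrow> ('k \<Rightarrow>\<^sub>0 'a) \<Rightarrow> _"
  by unfold_locales (auto intro!: poly_mapping_eqI simp: lookup_add algebra_simps)

text \<open>The vector space with basis \<open>Tab\<close>; the tableau \<open>S\<close>, as a basis vector, is \<open>tab_vec S\<close>.\<close>

definition V :: "nat list \<Rightarrow> (tableau \<Rightarrow>\<^sub>0 'a::field) set" where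
  "V \<mu> = {v. Poly_Mapping.keys v \<subseteq> Tab \<mu>}"

definition tab_vec :: "tableau \<Rightarrow> (tableau \<Rightarrow>\<^sub>0 'a::field)" where
  "tab_vec S = Poly_Mapping.single S 1"


section \<open>Polynomials and the action of permutations on variables\<close>

text \<open>A monomial is its finitely supported exponent function; multiplication is the convolution
  product of \<^theory>\<open>HOL-Library.Poly_Mapping\<close>.\<close>

type_synonym 'a mpoly = "(nat \<Rightarrow>\<^sub>0 nat) \<Rightarrow>\<^sub>0 'a"

definition var :: "nat \<Rightarrow> 'a::field mpoly" where
  "var i = Poly_Mapping.single (Poly_Mapping.single i 1) 1"

definition polys :: "nat \<Rightarrow> 'a::field mpoly set" where
  "polys N = {f. \<forall>m\<in>Poly_Mapping.keys f. Poly_Mapping.keys m \<subseteq> {1..N}}"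

text \<open>Operators act on the right, so a product of permutations is carried out from left to right
  and is \<open>\<pi> \<circ> \<sigma>\<close> when \<open>\<sigma>\<close> comes first. With this convention the action on
  polynomials is the algebra homomorphism with \<open>x\<^sub>i \<mapsto> x\<^bsub>\<sigma> i\<^esub>\<close>
  (see \<open>poly_act_var\<close>, \<open>poly_act_times\<close>, \<open>poly_act_comp\<close>): the coefficient of \<open>m\<close> in the
  image of \<open>f\<close> is the coefficient of \<open>m \<circ> \<sigma>\<close> in \<open>f\<close>. It is meant for bijections \<open>\<sigma>\<close> only.\<close>

definition poly_act :: "(nat \<Rightarrow> nat) \<Rightarrow> 'a::field mpoly \<Rightarrow> 'a mpoly" where
  "poly_act \<sigma> f = Poly_Mapping.map_key (Poly_Mapping.map_key \<sigma>) f"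

lemma inj_map_key: "inj (Poly_Mapping.map_key \<sigma> :: (nat \<Rightarrow>\<^sub>0 nat) \<Rightarrow> _)" if bij: "bij \<sigma>"
proof (rule injI)
  fix m n :: "nat \<Rightarrow>\<^sub>0 nat"
  assume eq: "Poly_Mapping.map_key \<sigma> m = Poly_Mapping.map_key \<sigma> n"
  show "m = n"
  proof (rule poly_mapping_eqI)
    fix k
    obtain j where "k = \<sigma> j" using surjD[OF bij_is_surj[OF bij], of k] by blast
    then show "Poly_Mapping.lookup m k = Poly_Mapping.lookup n k"
      using arg_cong[OF eq, of "\<lambda>q. Poly_Mapping.lookup q j"] bij
      by (simp add: map_key.rep_eq bij_is_inj)
  qed
qed

lemma lookup_poly_act:
  "bij \<sigma> \<Longrightarrow> Poly_Mapping.lookup (poly_act \<sigma> f) m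
     = Poly_Mapping.lookup f (Poly_Mapping.map_key \<sigma> m)"
  by (simp add: poly_act_def map_key.rep_eq inj_map_key)

lemma poly_act_add: "bij \<sigma> \<Longrightarrow> poly_act \<sigma> (f + g) = poly_act \<sigma> f + poly_act \<sigma> g"
  by (simp add: poly_act_def map_key_plus inj_map_key)

lemma poly_act_smul: "bij \<sigma> \<Longrightarrow> poly_act \<sigma> (smul c f) = smul c (poly_act \<sigma> f)"
  by (rule poly_mapping_eqI) (simp add: lookup_poly_act)

lemma poly_act_comp:
  assumes "bij \<sigma>" "bij \<pi>"
  shows "poly_act (\<pi> \<circ> \<sigma>) f = poly_act \<pi> (poly_act \<sigma> f)"
  using assms
  by (intro poly_mapping_eqI) (simp add: lookup_poly_act bij_comp map_key_compose bij_is_inj)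

lemma poly_act_single:
  assumes "bij \<sigma>"
  shows "poly_act \<sigma> (Poly_Mapping.single m c)
     = Poly_Mapping.single (Poly_Mapping.map_key (inv \<sigma>) m) c"
proof -
  have inj: "inj \<sigma>" "inj (inv \<sigma>)" using assms by (simp_all add: bij_is_inj bij_imp_bij_inv)
  have "\<sigma> \<circ> inv \<sigma> = id" "inv \<sigma> \<circ> \<sigma> = id"
    using assms by (simp_all add: bij_is_inj bij_is_surj flip: surj_iff)
  then have "Poly_Mapping.map_key \<sigma> (Poly_Mapping.map_key (inv \<sigma>) m) = m"
    using inj by (simp add: map_key_compose map_key_id id_def)
  then show ?thesis
    using map_key_single[OF inj_map_key[OF assms], of "Poly_Mapping.map_key (inv \<sigma>) m" c]
    by (simp add: poly_act_def)
qed

lemma poly_act_var: "bij \<sigma> \<Longrightarrow> poly_act \<sigma> (var i) = var (\<sigma> i)"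
  using map_key_single[of "inv \<sigma>" "\<sigma> i" "1::nat"]
  by (simp add: var_def poly_act_single bij_is_inj bij_imp_bij_inv)

lemma pm_induct [case_names zero add]:
  fixes f :: "'k \<Rightarrow>\<^sub>0 'a::comm_monoid_add"
  assumes "P 0" and "\<And>k c f. P f \<Longrightarrow> P (Poly_Mapping.single k c + f)"
  shows "P f"
proof (induction f rule: update_induct)
  case (update f k c)
  then have "Poly_Mapping.update k c f = Poly_Mapping.single k c + f"
    by (intro poly_mapping_eqI)
      (auto simp: lookup_update lookup_add lookup_single when_def in_keys_iff)
  then show ?case using assms(2) update.IH by simp
qed (rule assms(1))

lemma poly_act_times:
  assumes "bij \<sigma>"
  shows "poly_act \<sigma> (f * g) = poly_act \<sigma> f * poly_act \<sigma> g"
proof -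
  have zero: "poly_act \<sigma> 0 = 0"
    by (rule poly_mapping_eqI) (simp add: lookup_poly_act assms)
  have s: "poly_act \<sigma> (Poly_Mapping.single m c * g)
      = poly_act \<sigma> (Poly_Mapping.single m c) * poly_act \<sigma> g" for m c
  proof (induction g rule: pm_induct)
    case (add k v g)
    then show ?case
      using assms
      by (simp add: distrib_left poly_act_add mult_single poly_act_single map_key_plus
          bij_is_inj bij_imp_bij_inv)
  qed (simp add: zero)
  show ?thesis
    by (induction f rule: pm_induct) (simp_all add: s zero distrib_right poly_act_add assms)
qed


section \<open>The representation on tableaux and bases of the same isotype\<close>

text \<open>Young's seminormal formulas for the simple transpositions, for a family \<open>e\<close> indexed by
  tableaux and an action \<open>act\<close> of permutations on the space containing it. The four cases are
  exhaustive: entries in the same row, entries in the same column, \<open>b \<ge> 2\<close> and \<open>b \<le> -2\<close>.\<close>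

definition young_formulas ::
    "nat list \<Rightarrow> ((nat \<Rightarrow> nat) \<Rightarrow> ('k \<Rightarrow>\<^sub>0 'a) \<Rightarrow> ('k \<Rightarrow>\<^sub>0 'a)) \<Rightarrow> (tableau \<Rightarrow> ('k \<Rightarrow>\<^sub>0 'a::field)) \<Rightarrow> bool"
  where
  "young_formulas \<mu> act e \<longleftrightarrow>
    (\<forall>S\<in>Tab \<mu>. \<forall>i. 1 \<le> i \<and> i < sum_list \<mu> \<longrightarrow>
      (let b = content \<mu> S i - content \<mu> S (i + 1) in
       (row \<mu> S i = row \<mu> S (i + 1) \<longrightarrow> act (simple_transp i) (e S) = e S) \<and>
       (col \<mu> S i = col \<mu> S (i + 1) \<longrightarrow> act (simple_transp i) (e S) = - e S) \<and>
       (row \<mu> S i < row \<mu> S (i + 1) \<and> col \<mu> S i > col \<mu> S (i + 1) \<longrightarrow>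
          act (simple_transp i) (e S) = e (swap_entries \<mu> i S) + smul (1 / of_int b) (e S)) \<and>
       (b \<le> -2 \<longrightarrow>
          act (simple_transp i) (e S)
            = smul (1 - 1 / (of_int b)\<^sup>2) (e (swap_entries \<mu> i S)) + smul (1 / of_int b) (e S))))"

text \<open>\<open>T \<sigma> v\<close> is \<open>v\<close> acted on (from the right) by \<open>\<sigma>\<close>.
  Only the values of \<open>T\<close> on \<open>V \<mu>\<close> matter.\<close>

definition linear_on_V :: "nat list \<Rightarrow> ((tableau \<Rightarrow>\<^sub>0 'a) \<Rightarrow> (tableau \<Rightarrow>\<^sub>0 'a::field)) \<Rightarrow> bool" where
  "linear_on_V \<mu> L \<longleftrightarrow>
     (\<forall>v\<in>V \<mu>. L v \<in> V \<mu>) \<and>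
     (\<forall>v\<in>V \<mu>. \<forall>w\<in>V \<mu>. L (v + w) = L v + L w) \<and>
     (\<forall>c. \<forall>v\<in>V \<mu>. L (smul c v) = smul c (L v))"

definition representation_on_V ::
    "nat list \<Rightarrow> ((nat \<Rightarrow> nat) \<Rightarrow> (tableau \<Rightarrow>\<^sub>0 'a) \<Rightarrow> (tableau \<Rightarrow>\<^sub>0 'a::field)) \<Rightarrow> bool" where
  "representation_on_V \<mu> T \<longleftrightarrow>
     (\<forall>\<sigma>. \<sigma> permutes {1..sum_list \<mu>} \<longrightarrow> linear_on_V \<mu> (T \<sigma>)) \<and>
     (\<forall>v\<in>V \<mu>. T id v = v) \<and>
     (\<forall>\<sigma> \<pi>. \<sigma> permutes {1..sum_list \<mu>} \<and> \<pi> permutes {1..sum_list \<mu>} \<longrightarrow>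
        (\<forall>v\<in>V \<mu>. T (\<pi> \<circ> \<sigma>) v = T \<pi> (T \<sigma> v)))"

definition young_representation ::
    "nat list \<Rightarrow> ((nat \<Rightarrow> nat) \<Rightarrow> (tableau \<Rightarrow>\<^sub>0 'a) \<Rightarrow> (tableau \<Rightarrow>\<^sub>0 'a::field)) \<Rightarrow> bool" where
  "young_representation \<mu> T \<longleftrightarrow> representation_on_V \<mu> T \<and> young_formulas \<mu> T tab_vec"

definition invariant_space :: "nat \<Rightarrow> 'a::field mpoly set \<Rightarrow> bool" where
  "invariant_space N U \<longleftrightarrow> pm.subspace U \<and> U \<subseteq> polys N \<and>
     (\<forall>\<sigma>. \<sigma> permutes {1..N} \<longrightarrow> (\<forall>f\<in>U. poly_act \<sigma> f \<in> U))"

definition isotype_basis :: "nat list \<Rightarrow> 'a::field mpoly set \<Rightarrow> (tableau \<Rightarrow> 'a mpoly) \<Rightarrow> bool" where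
  "isotype_basis \<mu> U g \<longleftrightarrow>
     invariant_space (sum_list \<mu>) U \<and>
     inj_on g (Tab \<mu>) \<and> pm.independent (g ` Tab \<mu>) \<and> pm.span (g ` Tab \<mu>) = U \<and>
     young_formulas \<mu> poly_act g"


section \<open>Vector-valued polynomials\<close>

text \<open>As \<open>V\<close> has basis \<open>Tab\<close>, the tensor product of \<open>polys N\<close> and \<open>V\<close> consists of the sums of
  \<open>f\<^sub>S \<otimes> S\<close> with \<open>S\<close> in \<open>Tab\<close>; such a sum is encoded by the family of its coefficients
  \<open>f\<^sub>S\<close>, and \<open>tensor f v\<close> is the pure tensor of \<open>f\<close> and \<open>v\<close>.\<close>

definition P_tau :: "nat list \<Rightarrow> (tableau \<Rightarrow>\<^sub>0 'a::field mpoly) set" where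
  "P_tau \<mu> = {p. Poly_Mapping.keys p \<subseteq> Tab \<mu> \<and>
     (\<forall>S. Poly_Mapping.lookup p S \<in> polys (sum_list \<mu>))}"

definition tensor :: "'a::field mpoly \<Rightarrow> (tableau \<Rightarrow>\<^sub>0 'a) \<Rightarrow> (tableau \<Rightarrow>\<^sub>0 'a mpoly)" where
  "tensor f v = Poly_Mapping.map (\<lambda>c. smul c f) v"

lemma lookup_tensor [simp]:
  "Poly_Mapping.lookup (tensor f v) S = smul (Poly_Mapping.lookup v S) f"
  by (simp add: tensor_def Poly_Mapping.map.rep_eq when_def)

text \<open>The tensor product of the action of \<open>\<sigma>\<close> on polynomials with \<open>T \<sigma>\<close>,
  given by its values on the \<open>f\<^sub>S \<otimes> S\<close>; see \<open>t_op_tensor\<close> for arbitrary pure tensors.\<close>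

definition t_op ::
    "nat list \<Rightarrow> ((nat \<Rightarrow> nat) \<Rightarrow> (tableau \<Rightarrow>\<^sub>0 'a) \<Rightarrow> (tableau \<Rightarrow>\<^sub>0 'a::field))
      \<Rightarrow> (nat \<Rightarrow> nat) \<Rightarrow> (tableau \<Rightarrow>\<^sub>0 'a mpoly) \<Rightarrow> (tableau \<Rightarrow>\<^sub>0 'a mpoly)" where
  "t_op \<mu> T \<sigma> p =
     (\<Sum>S\<in>Tab \<mu>. tensor (poly_act \<sigma> (Poly_Mapping.lookup p S)) (T \<sigma> (tab_vec S)))"

definition rho :: "nat list \<Rightarrow> (tableau \<Rightarrow> 'a::field mpoly) \<Rightarrow> (tableau \<Rightarrow>\<^sub>0 'a mpoly) \<Rightarrow> 'a mpoly"
  where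
  "rho \<mu> g p = (\<Sum>S\<in>Tab \<mu>. Poly_Mapping.lookup p S * g S)"

text \<open>\<open>rho\<close> is linear over the polynomial ring and has polynomial values.\<close>

lemma rho_add: "rho \<mu> g (p + q) = rho \<mu> g p + rho \<mu> g q"
  by (simp add: rho_def lookup_add distrib_right sum.distrib)

lemma rho_times: "rho \<mu> g (Poly_Mapping.map ((*) f) p) = f * rho \<mu> g p"
proof -
  have "Poly_Mapping.lookup (Poly_Mapping.map ((*) f) p) S = f * Poly_Mapping.lookup p S" for S
    by (simp add: Poly_Mapping.map.rep_eq when_def)
  then show ?thesis by (simp add: rho_def sum_distrib_left mult.assoc)
qed

lemma polys_mult: "f * h \<in> polys N" if "f \<in> polys N" "h \<in> polys N"
  for f h :: "'a::field mpoly"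
proof -
  have "Poly_Mapping.keys (a + b) \<subseteq> {1..N}"
    if "Poly_Mapping.keys a \<subseteq> {1..N}" "Poly_Mapping.keys b \<subseteq> {1..N}" for a b :: "nat \<Rightarrow>\<^sub>0 nat"
    using that keys_add[of a b] by blast
  then have closed: "Poly_Mapping.keys (a + b) \<subseteq> {1..N}"
    if "a \<in> Poly_Mapping.keys f" "b \<in> Poly_Mapping.keys h" for a b
    using that \<open>f \<in> polys N\<close> \<open>h \<in> polys N\<close> by (simp add: polys_def)
  show ?thesis unfolding polys_def
  proof (rule CollectI, rule ballI)
    fix m assume "m \<in> Poly_Mapping.keys (f * h)"
    then obtain a b where "m = a + b" "a \<in> Poly_Mapping.keys f" "b \<in> Poly_Mapping.keys h"
      using keys_mult[of f h] by blast
    then show "Poly_Mapping.keys m \<subseteq> {1..N}" using closed by simp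
  qed
qed

lemma rho_in_polys:
  assumes "p \<in> P_tau \<mu>" "\<And>S. S \<in> Tab \<mu> \<Longrightarrow> g S \<in> polys (sum_list \<mu>)"
  shows "rho \<mu> g p \<in> polys (sum_list \<mu>)"
proof -
  have "Poly_Mapping.lookup p S * g S \<in> polys (sum_list \<mu>)" if "S \<in> Tab \<mu>" for S
    using assms that by (auto intro: polys_mult simp: P_tau_def)
  then have "(\<Union>S\<in>Tab \<mu>. Poly_Mapping.keys (Poly_Mapping.lookup p S * g S))
      \<subseteq> {m. Poly_Mapping.keys m \<subseteq> {1..sum_list \<mu>}}"
    unfolding polys_def by blast
  with keys_sum have "Poly_Mapping.keys (rho \<mu> g p) \<subseteq> {m. Poly_Mapping.keys m \<subseteq> {1..sum_list \<mu>}}"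
    unfolding rho_def by (rule subset_trans)
  then show ?thesis unfolding polys_def by blast
qed

lemma finite_Tab: "finite (Tab \<mu>)"
proof -
  have "boxes \<mu> \<subseteq> (SIGMA i:{..length \<mu>}. {..\<mu> ! (i - 1)})"
    by (auto simp: boxes_def)
  then have "finite (boxes \<mu>)" by (rule finite_subset) auto
  then have "finite (boxes \<mu> \<rightarrow>\<^sub>E {1..sum_list \<mu>})" by (intro finite_PiE) auto
  then show ?thesis
    by (rule finite_subset[rotated]) (auto simp: Tab_def PiE_def bij_betw_def)
qed

lemma V_expansion: "v = (\<Sum>S\<in>Tab \<mu>. smul (Poly_Mapping.lookup v S) (tab_vec S))" if "v \<in> V \<mu>"
proof (rule poly_mapping_eqI)
  fix R
  show "Poly_Mapping.lookup v R
      = Poly_Mapping.lookup (\<Sum>S\<in>Tab \<mu>. smul (Poly_Mapping.lookup v S) (tab_vec S)) R"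
    using that
    by (auto simp: lookup_sum tab_vec_def lookup_single when_def V_def finite_Tab sum.delta
        if_distrib[of "(*) _"] in_keys_iff cong: if_cong)
qed

lemma t_op_tensor:
  fixes f :: "'a::field mpoly"
  assumes L: "linear_on_V \<mu> (T \<sigma>)" and "bij \<sigma>" "v \<in> V \<mu>"
  shows "t_op \<mu> T \<sigma> (tensor f v) = tensor (poly_act \<sigma> f) (T \<sigma> v)"
proof -
  have tab: "tab_vec S \<in> V \<mu>" if "S \<in> Tab \<mu>" for S using that by (simp add: V_def tab_vec_def)
  have smulV: "smul c w \<in> V \<mu>" if "w \<in> V \<mu>" for c and w :: "tableau \<Rightarrow>\<^sub>0 'a"
    using that by (auto simp: V_def in_keys_iff)
  have zeroV: "(0 :: tableau \<Rightarrow>\<^sub>0 'a) \<in> V \<mu>" by (simp add: V_def)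
  have T0: "T \<sigma> 0 = 0"
    using L zeroV unfolding linear_on_V_def by (metis add_cancel_right_right)
  have "(\<Sum>S\<in>A. smul (c S) (tab_vec S)) \<in> V \<mu> \<and>
      T \<sigma> (\<Sum>S\<in>A. smul (c S) (tab_vec S)) = (\<Sum>S\<in>A. smul (c S) (T \<sigma> (tab_vec S)))"
    if "A \<subseteq> Tab \<mu>" for A and c :: "tableau \<Rightarrow> 'a"
    using finite_subset[OF that finite_Tab] that
  proof (induction A rule: finite_induct)
    case empty
    then show ?case by (simp add: T0 zeroV)
  next
    case (insert S A)
    have "a + b \<in> V \<mu>" if "a \<in> V \<mu>" "b \<in> V \<mu>" for a b :: "tableau \<Rightarrow>\<^sub>0 'a"
      using that keys_add[of a b] by (auto simp: V_def)
    moreover have "smul (c S) (tab_vec S) \<in> V \<mu>" "(tab_vec S :: tableau \<Rightarrow>\<^sub>0 'a) \<in> V \<mu>"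
      using insert.prems by (auto intro: smulV tab)
    ultimately show ?case using insert L unfolding linear_on_V_def by simp
  qed
  from this[OF subset_refl, of "Poly_Mapping.lookup v"]
  have Tv: "T \<sigma> v = (\<Sum>S\<in>Tab \<mu>. smul (Poly_Mapping.lookup v S) (T \<sigma> (tab_vec S)))"
    using V_expansion[OF assms(3)] by simp
  show ?thesis
    unfolding t_op_def Tv
    by (intro poly_mapping_eqI)
      (simp add: lookup_sum poly_act_smul assms(2) sum_distrib_left algebra_simps)
qed

end

theory Submission
  imports Defs
begin

text \<open>On pure tensors the map is \<open>f \<otimes> v \<mapsto> f \<cdot> \<phi> v\<close>, where \<open>\<phi>\<close> is the linear map with
  \<open>S \<mapsto> g\<^sub>S\<close>. As permutations act on polynomials by algebra homomorphisms, it suffices that \<open>\<phi>\<close>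
  intertwines \<open>\<tau>(\<sigma>)\<close> with \<open>\<sigma>\<close>. For simple transpositions this is the coincidence of the two
  sets of formulas (I)--(IV), which cover every tableau; simple transpositions generate the
  symmetric group.\<close>

text \<open>The map \<phi> of the overview. Summing over the support makes it linear on all finitely
  supported functions, not just on \<open>V \<mu>\<close>.\<close>

definition lin_ext :: "('s \<Rightarrow> 'k \<Rightarrow>\<^sub>0 'a::field) \<Rightarrow> ('s \<Rightarrow>\<^sub>0 'a) \<Rightarrow> ('k \<Rightarrow>\<^sub>0 'a)" where
  "lin_ext g v = (\<Sum>S\<in>Poly_Mapping.keys v. smul (Poly_Mapping.lookup v S) (g S))"

lemma lin_ext_superset:
  assumes "finite A" "Poly_Mapping.keys v \<subseteq> A"
  shows "lin_ext g v = (\<Sum>S\<in>A. smul (Poly_Mapping.lookup v S) (g S))"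
  unfolding lin_ext_def using assms
  by (intro sum.mono_neutral_left) (auto simp: in_keys_iff)

lemma lin_ext_add: "lin_ext g (v + w) = lin_ext g v + lin_ext g w"
proof -
  let ?A = "Poly_Mapping.keys v \<union> Poly_Mapping.keys w"
  have "Poly_Mapping.keys (v + w) \<subseteq> ?A" by (rule keys_add)
  then show ?thesis
    by (simp add: lin_ext_superset[of ?A] lookup_add pm.scale_left_distrib sum.distrib)
qed

lemma lin_ext_smul: "lin_ext g (smul c v) = smul c (lin_ext g v)"
proof -
  have "Poly_Mapping.keys (smul c v) \<subseteq> Poly_Mapping.keys v"
    by (auto simp: in_keys_iff)
  then show ?thesis
    by (simp add: lin_ext_superset[of "Poly_Mapping.keys v"] pm.scale_sum_right)
qed

lemma lin_ext_uminus: "lin_ext g (- v) = - lin_ext g v"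
  by (simp add: lin_ext_def sum_negf)

lemma lin_ext_tab_vec: "lin_ext g (tab_vec S) = g S"
  by (simp add: lin_ext_def tab_vec_def)

text \<open>Scaling by \<open>c\<close> is multiplication by the constant polynomial
  \<open>c\<close>, so associativity of the product applies.\<close>

lemma smul_mult_left: "smul c f * h = smul c (f * h)" for f h :: "'a::field mpoly"
proof -
  have smul_eq: "smul c f = Poly_Mapping.single 0 c * f" for f :: "'a mpoly"
  proof (induction f rule: pm_induct)
    case (add k d f)
    have "smul c (Poly_Mapping.single k d) = Poly_Mapping.single 0 c * Poly_Mapping.single k d"
      by (intro poly_mapping_eqI) (simp add: mult_single lookup_single when_def)
    with add show ?case by (simp add: pm.scale_right_distrib distrib_left)
  qed simp
  show ?thesis by (simp add: smul_eq mult.assoc)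
qed

lemma rho_tensor:
  assumes "v \<in> V \<mu>"
  shows "rho \<mu> g (tensor f v) = f * lin_ext g v"
proof -
  have "smul c f * g S = f * smul c (g S)" for c S
    by (metis mult.commute smul_mult_left)
  with assms show ?thesis
    by (simp add: rho_def V_def lin_ext_superset[OF finite_Tab] sum_distrib_left)
qed

lemma tab_vec_in_V: "S \<in> Tab \<mu> \<Longrightarrow> tab_vec S \<in> V \<mu>"
  by (simp add: V_def tab_vec_def)

lemma rho_sum: "rho \<mu> g (\<Sum>S\<in>A. p S) = (\<Sum>S\<in>A. rho \<mu> g (p S))"
  by (induction A rule: infinite_finite_induct) (simp_all add: rho_add, simp_all add: rho_def)

lemma poly_act_sum:
  assumes "bij \<sigma>"
  shows "poly_act \<sigma> (\<Sum>S\<in>A. p S) = (\<Sum>S\<in>A. poly_act \<sigma> (p S))"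
proof -
  have "poly_act \<sigma> 0 = (0 :: 'a::field mpoly)"
    by (rule poly_mapping_eqI) (simp add: lookup_poly_act assms)
  then show ?thesis
    by (induction A rule: infinite_finite_induct) (simp_all add: poly_act_add assms)
qed

text \<open>Basis vectors suffice because \<open>t_op\<close> is defined through its values on the
  f_S \<otimes> S; multiplicativity of \<open>poly_act\<close> then acts on the factors f_S and g_S
  separately.\<close>

lemma rho_t_op:
  assumes lin: "linear_on_V \<mu> (T \<sigma>)" and bij: "bij \<sigma>"
    and basis: "\<And>S. S \<in> Tab \<mu> \<Longrightarrow> lin_ext g (T \<sigma> (tab_vec S)) = poly_act \<sigma> (g S)"
  shows "rho \<mu> g (t_op \<mu> T \<sigma> p) = poly_act \<sigma> (rho \<mu> g p)"
proof -
  have "T \<sigma> (tab_vec S) \<in> V \<mu>" if "S \<in> Tab \<mu>" for S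
    using lin that by (simp add: linear_on_V_def tab_vec_in_V)
  then have "rho \<mu> g (t_op \<mu> T \<sigma> p)
      = (\<Sum>S\<in>Tab \<mu>. poly_act \<sigma> (Poly_Mapping.lookup p S) * poly_act \<sigma> (g S))"
    by (simp add: t_op_def rho_sum rho_tensor basis)
  also have "\<dots> = poly_act \<sigma> (rho \<mu> g p)"
    by (simp add: rho_def poly_act_sum bij poly_act_times)
  finally show ?thesis .
qed

text \<open>Passes from basis vectors to all of \<open>V \<mu>\<close> by applying
  \<open>rho_t_op\<close> to 1 \<otimes> v: the constant 1 is fixed by the action, and
  \<open>rho\<close> sends 1 \<otimes> v to \<open>lin_ext g v\<close>.\<close>

lemma lin_ext_intertwines:
  assumes lin: "linear_on_V \<mu> (T \<sigma>)" and bij: "bij \<sigma>"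
    and basis: "\<And>S. S \<in> Tab \<mu> \<Longrightarrow> lin_ext g (T \<sigma> (tab_vec S)) = poly_act \<sigma> (g S)"
    and v: "v \<in> V \<mu>"
  shows "lin_ext g (T \<sigma> v) = poly_act \<sigma> (lin_ext g v)"
proof -
  have "poly_act \<sigma> 1 = (1 :: 'a mpoly)"
    using poly_act_single[OF bij, of 0 "1::'a"] bij
    by (simp add: bij_imp_bij_inv bij_is_inj)
  moreover have "T \<sigma> v \<in> V \<mu>" using lin v by (simp add: linear_on_V_def)
  ultimately show ?thesis
    using rho_t_op[where T = T and \<sigma> = \<sigma> and p = "tensor 1 v", OF lin bij basis]
    by (simp add: t_op_tensor lin bij v rho_tensor)
qed

text \<open>Row lengths weakly decrease. This supplies the corner boxes through which two boxes in
  different rows and columns are compared.\<close>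

lemma boxes_downward_closed:
  assumes "sorted_wrt (\<ge>) \<mu>" "(i', j') \<in> boxes \<mu>" "1 \<le> i" "i \<le> i'" "1 \<le> j" "j \<le> j'"
  shows "(i, j) \<in> boxes \<mu>"
proof -
  have "\<mu> ! (i' - 1) \<le> \<mu> ! (i - 1)"
    using assms sorted_wrt_nth_less[of "(\<ge>)" \<mu> "i - 1" "i' - 1"]
    by (cases "i = i'") (auto simp: boxes_def)
  then show ?thesis using assms by (auto simp: boxes_def)
qed

lemma row_col_entry:
  assumes "S \<in> Tab \<mu>" "1 \<le> k" "k \<le> sum_list \<mu>"
  shows "(row \<mu> S k, col \<mu> S k) \<in> boxes \<mu>" "S (row \<mu> S k, col \<mu> S k) = k"
proof -
  have S: "bij_betw S (boxes \<mu>) {1..sum_list \<mu>}" using assms by (simp add: Tab_def)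
  show "S (row \<mu> S k, col \<mu> S k) = k"
    using f_the_inv_into_f_bij_betw[OF S] assms by (simp add: row_def col_def)
  show "(row \<mu> S k, col \<mu> S k) \<in> boxes \<mu>"
    using bij_betw_apply[OF bij_betw_the_inv_into[OF S]] assms by (simp add: row_def col_def)
qed

lemma entry_decreasing:
  assumes "sorted_wrt (\<ge>) \<mu>" "S \<in> Tab \<mu>" "(i, j) \<in> boxes \<mu>" "(i', j') \<in> boxes \<mu>"
    and "i < i'" "j < j'"
  shows "S (i', j') < S (i, j)"
proof -
  \<comment> \<open>The corner: one descent along row \<open>i\<close>, then one down column
    \<open>j'\<close>.\<close>
  have "(i, j') \<in> boxes \<mu>"
    using assms by (intro boxes_downward_closed[of \<mu> i' j' i j']) (auto simp: boxes_def)
  then have "S (i, j') < S (i, j)" "S (i', j') < S (i, j')"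
    using assms by (auto simp: Tab_def)
  then show ?thesis by simp
qed

text \<open>If \<open>i\<close> and \<open>i + 1\<close> share neither row nor column, neither can
  lie strictly below and to the right of the other: entries decrease in that direction, and no entry
  fits strictly between them.\<close>

lemma young_cases:
  assumes part: "sorted_wrt (\<ge>) \<mu>" and S: "S \<in> Tab \<mu>" and i: "1 \<le> i" "i < sum_list \<mu>"
  obtains (same_row) "row \<mu> S i = row \<mu> S (i + 1)"
    | (same_col) "col \<mu> S i = col \<mu> S (i + 1)"
    | (above_right) "row \<mu> S i < row \<mu> S (i + 1)" "col \<mu> S i > col \<mu> S (i + 1)"
    | (below_left) "content \<mu> S i - content \<mu> S (i + 1) \<le> -2"
proof -
  note 1 = row_col_entry[OF S, of i] and 2 = row_col_entry[OF S, of "i + 1"]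
  have "\<not> (row \<mu> S i < row \<mu> S (i + 1) \<and> col \<mu> S i < col \<mu> S (i + 1))"
    using entry_decreasing[OF part S 1(1) 2(1)] 1(2) 2(2) i by auto
  moreover have "\<not> (row \<mu> S (i + 1) < row \<mu> S i \<and> col \<mu> S (i + 1) < col \<mu> S i)"
  proof
    \<comment> \<open>the box in the corner would carry an entry strictly between \<open>i\<close> and \<open>i + 1\<close>\<close>
    let ?r = "row \<mu> S (i + 1)" and ?c = "col \<mu> S i"
    assume less: "?r < row \<mu> S i \<and> col \<mu> S (i + 1) < ?c"
    have "(?r, ?c) \<in> boxes \<mu>"
      using 1 2 i less
      by (intro boxes_downward_closed[OF part, of "row \<mu> S i" ?c ?r ?c]) (auto simp: boxes_def)
    then have "S (?r, ?c) < S (?r, col \<mu> S (i + 1))" "S (row \<mu> S i, ?c) < S (?r, ?c)"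
      using S 1(1) 2(1) i less by (simp_all add: Tab_def)
    then show False using 1 2 i by simp
  qed
  \<comment> \<open>What remains is \<open>i\<close> strictly below and to the left of
    \<open>i + 1\<close>; row and column each contribute at least 1 to the content difference,
    whence the bound -2.\<close>
  ultimately show thesis using that unfolding content_def by linarith
qed

text \<open>The positions of \<open>i\<close> and \<open>i + 1\<close> in \<open>S\<close> alone
  decide which formula applies, so both families obey the same one, with the same
  coefficients.\<close>

lemma lin_ext_simple_transp:
  assumes part: "sorted_wrt (\<ge>) \<mu>" and S: "S \<in> Tab \<mu>" and i: "1 \<le> i" "i < sum_list \<mu>"
    and T: "young_formulas \<mu> T tab_vec" and g: "young_formulas \<mu> poly_act g"
  shows "lin_ext g (T (simple_transp i) (tab_vec S)) = poly_act (simple_transp i) (g S)"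
  using part S i
proof (cases rule: young_cases)
  case same_row
  then show ?thesis
    using T g S i by (simp add: young_formulas_def Let_def lin_ext_tab_vec)
next
  case same_col
  then show ?thesis
    using T g S i by (simp add: young_formulas_def Let_def lin_ext_tab_vec lin_ext_uminus)
next
  case above_right
  then show ?thesis
    using T g S i
    by (simp add: young_formulas_def Let_def lin_ext_tab_vec lin_ext_add lin_ext_smul)
next
  case below_left
  then show ?thesis
    using T g S i
    by (simp add: young_formulas_def Let_def lin_ext_tab_vec lin_ext_add lin_ext_smul)
qed

text \<open>Permutations are products of transpositions, and these arise from adjacent ones by
  conjugation.\<close>

lemma permutes_adjacent_induct [consumes 1, case_names id simple comp]:
  assumes \<sigma>: "\<sigma> permutes {1..N}"
    and id: "P id"
    and simple: "\<And>i. 1 \<le> i \<Longrightarrow> i < N \<Longrightarrow> P (simple_transp i)"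
    and comp: "\<And>\<sigma> \<pi>. \<sigma> permutes {1..N} \<Longrightarrow> \<pi> permutes {1..N} \<Longrightarrow> P \<sigma> \<Longrightarrow> P \<pi> \<Longrightarrow> P (\<pi> \<circ> \<sigma>)"
  shows "P \<sigma>"
proof -
  have adj: "P (transpose a (a + Suc d))" if "1 \<le> a" "a + Suc d \<le> N" for a d
    using that
  proof (induction d)
    case 0
    then show ?case using simple[of a] by simp
  next
    case (Suc d)
    let ?b = "a + Suc d"
    have perm: "simple_transp ?b permutes {1..N}" "transpose a ?b permutes {1..N}"
      using Suc.prems by (auto intro!: permutes_swap_id)
    \<comment> \<open>Conjugating (a b) by (b b+1) gives (a b+1), which lengthens the distance by
      one.\<close>
    have "P (simple_transp ?b \<circ> (transpose a ?b \<circ> simple_transp ?b))"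
      using Suc perm by (intro comp permutes_compose simple) auto
    also have "simple_transp ?b \<circ> (transpose a ?b \<circ> simple_transp ?b)
        = transpose a (a + Suc (Suc d))"
      by (auto simp: fun_eq_iff transpose_def)
    finally show ?case .
  qed
  have transp: "P (transpose a b)" if "a \<in> {1..N}" "b \<in> {1..N}" for a b
  proof (cases a b rule: linorder_cases)
    case less
    \<comment> \<open>The offset -1 is due to \<open>adj\<close> writing the distance as
      \<open>Suc d\<close>.\<close>
    then show ?thesis using adj[of a "b - a - 1"] that by auto
  next
    case greater
    then show ?thesis
      using adj[of b "a - b - 1"] that
      by (auto simp: transpose_commute)
  qed (simp add: id)
  show ?thesis
    using \<sigma> finite_atLeastAtMost
  proof (induction rule: permutes_induct)
    case (swap a b \<pi>)
    then show ?case by (intro comp transp permutes_swap_id)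
  qed (use id in \<open>simp_all add: id_def\<close>)
qed

theorem proposition3p1:
  fixes N :: nat and \<tau> :: "nat list"
    and \<iota> :: "complex \<Rightarrow> 'a::field"
    and T :: "(nat \<Rightarrow> nat) \<Rightarrow> (tableau \<Rightarrow>\<^sub>0 'a) \<Rightarrow> (tableau \<Rightarrow>\<^sub>0 'a)"
    and U :: "'a mpoly set" and g :: "tableau \<Rightarrow> 'a mpoly"
  assumes "N \<ge> 2" and "partition_of N \<tau>"
    and "field_extension_of_complex \<iota>"
    and "young_representation \<tau> T"
    and "isotype_basis \<tau> U g"
  shows "\<forall>\<sigma>. \<sigma> permutes {1..N} \<longrightarrow>
    (\<forall>p\<in>P_tau \<tau>. rho \<tau> g (t_op \<tau> T \<sigma> p) = poly_act \<sigma> (rho \<tau> g p))"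
proof (intro allI impI ballI)
  fix \<sigma> and p :: "tableau \<Rightarrow>\<^sub>0 'a mpoly"
  assume \<sigma>: "\<sigma> permutes {1..N}"
  have part: "sorted_wrt (\<ge>) \<tau>" and N: "sum_list \<tau> = N"
    using assms(2) by (auto simp: partition_of_def)
  have T: "representation_on_V \<tau> T" "young_formulas \<tau> T tab_vec"
    using assms(4) by (auto simp: young_representation_def)
  have g: "young_formulas \<tau> poly_act g"
    using assms(5) by (simp add: isotype_basis_def)
  have lin: "linear_on_V \<tau> (T \<sigma>)" if "\<sigma> permutes {1..N}" for \<sigma>
    using T that N by (simp add: representation_on_V_def)
  \<comment> \<open>The claim ranges over all of \<open>V \<tau>\<close> because
    \<open>T \<sigma>\<close> need not send a tableau to a tableau: in the composition step the
    hypothesis for \<pi> is applied to \<open>T \<sigma> v\<close>.\<close>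
  have "\<forall>v\<in>V \<tau>. lin_ext g (T \<sigma> v) = poly_act \<sigma> (lin_ext g v)"
    using \<sigma>
  proof (induction rule: permutes_adjacent_induct)
    case id
    have "poly_act id f = f" for f :: "'a mpoly"
      by (rule poly_mapping_eqI) (simp add: lookup_poly_act[OF bij_id] map_key_id[folded id_def])
    then show ?case using T by (simp add: representation_on_V_def id_def)
  next
    case (simple i)
    have "simple_transp i permutes {1..N}"
      using simple by (auto intro!: permutes_swap_id)
    then show ?case
      using lin_ext_simple_transp[OF part _ _ _ T(2) g] simple N
      by (auto intro!: lin_ext_intertwines lin bij_swap)
  next
    case (comp \<sigma> \<pi>)
    have "T (\<pi> \<circ> \<sigma>) v = T \<pi> (T \<sigma> v)" "T \<sigma> v \<in> V \<tau>" if "v \<in> V \<tau>" for v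
      using T(1) lin[OF comp(1)] comp(1,2) that N
      by (simp_all add: representation_on_V_def linear_on_V_def)
    then have "\<forall>v\<in>V \<tau>. lin_ext g (T (\<pi> \<circ> \<sigma>) v) = poly_act (\<pi> \<circ> \<sigma>) (lin_ext g v)"
      using comp by (simp add: poly_act_comp permutes_bij)
    then show ?case by (simp add: comp_def)
  qed
  \<comment> \<open>The instances \<open>v = tab_vec S\<close> are what \<open>rho_t_op\<close> asks
    for.\<close>
  then show "rho \<tau> g (t_op \<tau> T \<sigma> p) = poly_act \<sigma> (rho \<tau> g p)"
    using \<sigma> by (intro rho_t_op lin permutes_bij) (auto simp: tab_vec_in_V lin_ext_tab_vec)
qed

end
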